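(* Let $\mathcal{G}$ be a strongly connected and weight-balanced weighted digraph on $N$ nodes with Laplacian $L=[L_{ij}]$. Suppose each agent $i\in\{1,\dots,N\}$ has a piecewise continuously differentiable input $u^i:[0,\infty)\to\mathbb{R}$, and let $\alpha,\beta>0$. Consider $$\dot x^i=\dot u^i-\alpha(x^i-u^i)-\beta\sum_{j=1}^N L_{ij}x^j-v^i,\qquad \dot v^i=\alpha\beta\sum_{j=1}^N L_{ij}x^j,\qquad i\in\{1,\dots,N\}.$$ Then the trajectory starting from any initial condition $x(0),v(0)\in\mathbb{R}^N$ satisfies, for all $i\in\{1,\dots,N\}$ and $t\ge 0$, $$\Big|x^i(t)-\frac1N\sum_{j=1}^N u^j(t)+\frac{\alpha^{-1}}{N}\sum_{j=1}^N v^j(0)\Big|\le s(t)+\int_0^t e^{-\beta\hat\lambda_2(t-\tau)}\|\Pi_N\dot u(\tau)\|\,d\tau+g(t)\,\|\dot u(0)\|,$$ where $$g(t)=\begin{cases}(\beta\hat\lambda_2-\alpha)^{-1}(e^{-\alpha t}-e^{-\beta\hat\lambda_2 t}),&\alpha\ne\beta\hat\lambda_2,\\ t\,e^{-\beta\hat\lambda_2 t},&\alpha=\beta\hat\lambda_2,\end{cases}$$ $$s(t)=(e^{-\alpha t}+e^{-\beta\hat\lambda_2 t})\|y(0)\|+\alpha^{-1}e^{-\alpha t}\|w(0)\|+g(t)\big(\alpha\|y(0)\|+\|w(0)\|\big),$$ with $y(0)=x(0)-\big(\frac1N\sum_{j=1}^N u^j(0)\big)\mathbf{1}_N$ and $w(0)=v(0)-\Pi_N(\dot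 u(0)+\alpha u(0))$.
   Context: Weighted digraph $\mathcal{G}$ on nodes $\{1,\dots,N\}$, $N\ge2$: adjacency matrix $\mathsf{A}=[a_{ij}]$ with $a_{ij}>0$ if $(i,j)$ is an edge and $a_{ij}=0$ otherwise. Weight-balanced: $\sum_j a_{ij}=\sum_j a_{ji}$ for every $i$. Strongly connected: there is a directed path between every ordered pair of nodes. Laplacian: $L=D^{\rm out}-\mathsf{A}$, where $D^{\rm out}$ is diagonal with entries $d^{\rm out}(i)=\sum_j a_{ij}$. $\hat\lambda_2>0$ is the smallest nonzero eigenvalue of $\frac12(L+L^\top)$ (for a strongly connected weight-balanced digraph, $0$ is a simple eigenvalue of this positive semidefinite matrix). $\mathbf{1}_N$ is the vector of ones, $\Pi_N=I_N-\frac1N\mathbf{1}_N\mathbf{1}_N^\top$, $\|\cdot\|$ is the Euclidean norm, and unindexed symbols stack agent variables, e.g. $u=(u^1,\dots,u^N)$. "Piecewise continuously differentiable" means continuous with a piecewise continuous derivative; $\dot u(0)$ is the right derivative at $0$, and the differential equations hold away from the breakpoints, with continuous trajectories. *)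

theory Defs
  imports "HOL-Analysis.Analysis"
begin

section \<open>Weighted digraphs\<close>

text \<open>The finite type \<open>'n\<close> is the set of nodes, so \<open>N = CARD('n)\<close>; \<open>E\<close> is the edge set.
  Self-loops are not excluded (they cancel in the Laplacian).\<close>

definition weighted_digraph :: "('n \<times> 'n) set \<Rightarrow> real ^ 'n ^ 'n \<Rightarrow> bool" where
  "weighted_digraph E A \<longleftrightarrow>
     (\<forall>i j. ((i, j) \<in> E \<longrightarrow> A $ i $ j > 0) \<and> ((i, j) \<notin> E \<longrightarrow> A $ i $ j = 0))"

definition strongly_connected :: "('n \<times> 'n) set \<Rightarrow> bool" where
  "strongly_connected E \<longleftrightarrow> (\<forall>i j. (i, j) \<in> E\<^sup>*)"

definition weight_balanced :: "real ^ 'n ^ 'n \<Rightarrow> bool" where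
  "weight_balanced A \<longleftrightarrow> (\<forall>i. (\<Sum>j\<in>UNIV. A $ i $ j) = (\<Sum>j\<in>UNIV. A $ j $ i))"

definition out_degree_matrix :: "real ^ 'n ^ 'n \<Rightarrow> real ^ 'n ^ 'n" where
  "out_degree_matrix A = (\<chi> i j. if i = j then \<Sum>k\<in>UNIV. A $ i $ k else 0)"

definition laplacian :: "real ^ 'n ^ 'n \<Rightarrow> real ^ 'n ^ 'n" where
  "laplacian A = out_degree_matrix A - A"

definition eigenvalue :: "real ^ 'n ^ 'n \<Rightarrow> real \<Rightarrow> bool" where
  "eigenvalue M c \<longleftrightarrow> (\<exists>v. v \<noteq> 0 \<and> M *v v = c *\<^sub>R v)"

text \<open>Only real eigenvalues are considered, which is no restriction since the matrix is symmetric.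
  The set is finite; it is nonempty, so that \<open>Min\<close> is meaningful, for a strongly connected
  weight-balanced digraph with at least two nodes.\<close>

definition lambda2_hat :: "real ^ 'n ^ 'n \<Rightarrow> real" where
  "lambda2_hat L = Min {c. eigenvalue ((1 / 2) *\<^sub>R (L + transpose L)) c \<and> c \<noteq> 0}"

definition mean_proj :: "real ^ 'n ^ 'n" where
  "mean_proj = mat 1 - (1 / real CARD('n)) *\<^sub>R (\<chi> i j. 1)"


section \<open>Piecewise continuously differentiable inputs on \<open>[0, \<infinity>)\<close>\<close>

text \<open>The set \<open>B\<close> of breakpoints is locally finite and may be infinite. Nothing is required of the
  value of \<open>g\<close> at a breakpoint, but both one-sided limits must exist (and be finite) there.\<close>

definition piecewise_continuous :: "real set \<Rightarrow> (real \<Rightarrow> real) \<Rightarrow> bool" where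
  "piecewise_continuous B g \<longleftrightarrow>
     B \<subseteq> {0<..} \<and> (\<forall>T. finite (B \<inter> {..T})) \<and> continuous_on ({0..} - B) g \<and>
     (\<forall>b\<in>B. (\<exists>l. (g \<longlongrightarrow> l) (at_left b)) \<and> (\<exists>r. (g \<longlongrightarrow> r) (at_right b)))"

text \<open>At \<open>t = 0\<close> this is the right derivative, at \<open>t > 0\<close> the ordinary one; at a point where there
  is no derivative the value is arbitrary.\<close>

definition half_line_deriv :: "(real \<Rightarrow> real) \<Rightarrow> real \<Rightarrow> real" where
  "half_line_deriv f t = vector_derivative f (at t within {0..})"

definition piecewise_cont_diff :: "real set \<Rightarrow> (real \<Rightarrow> real) \<Rightarrow> bool" where
  "piecewise_cont_diff B f \<longleftrightarrow>
     continuous_on {0..} f \<and>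
     (\<forall>t\<in>{0..} - B. f differentiable (at t within {0..})) \<and>
     piecewise_continuous B (half_line_deriv f)"

definition input_deriv :: "(real \<Rightarrow> real ^ 'n) \<Rightarrow> real \<Rightarrow> real ^ 'n" where
  "input_deriv u t = (\<chi> i. half_line_deriv (\<lambda>s. u s $ i) t)"


section \<open>The dynamics and the error bound\<close>

text \<open>\<open>S\<close> is the set of times at which the differential equations are not required to hold.\<close>

definition consensus_trajectory ::
  "real \<Rightarrow> real \<Rightarrow> real ^ 'n ^ 'n \<Rightarrow> (real \<Rightarrow> real ^ 'n) \<Rightarrow> real set \<Rightarrow>
   (real \<Rightarrow> real ^ 'n) \<Rightarrow> (real \<Rightarrow> real ^ 'n) \<Rightarrow> bool" where
  "consensus_trajectory \<alpha> \<beta> L u S x v \<longleftrightarrow>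
     continuous_on {0..} x \<and> continuous_on {0..} v \<and>
     (\<forall>i. \<forall>t\<in>{0..} - S.
        ((\<lambda>s. x s $ i) has_real_derivative
           (input_deriv u t $ i - \<alpha> * (x t $ i - u t $ i)
            - \<beta> * (\<Sum>j\<in>UNIV. L $ i $ j * x t $ j) - v t $ i)) (at t within {0..}) \<and>
        ((\<lambda>s. v s $ i) has_real_derivative
           (\<alpha> * \<beta> * (\<Sum>j\<in>UNIV. L $ i $ j * x t $ j))) (at t within {0..}))"

definition gain_fun :: "real \<Rightarrow> real \<Rightarrow> real \<Rightarrow> real \<Rightarrow> real" where
  "gain_fun \<alpha> \<beta> lam t =
     (if \<alpha> \<noteq> \<beta> * lam
      then inverse (\<beta> * lam - \<alpha>) * (exp (- \<alpha> * t) - exp (- \<beta> * lam * t))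
      else t * exp (- \<beta> * lam * t))"

definition transient_fun ::
  "real \<Rightarrow> real \<Rightarrow> real \<Rightarrow> real ^ 'n \<Rightarrow> real ^ 'n \<Rightarrow> real \<Rightarrow> real" where
  "transient_fun \<alpha> \<beta> lam y0 w0 t =
     (exp (- \<alpha> * t) + exp (- \<beta> * lam * t)) * norm y0
     + inverse \<alpha> * exp (- \<alpha> * t) * norm w0
     + gain_fun \<alpha> \<beta> lam t * (\<alpha> * norm y0 + norm w0)"

end

theory Submission
  imports Defs
begin

text \<open>
  The proof rests on a cancellation: the combination \<open>P = \<alpha> x + v - \<alpha> u\<close> obeys \<open>P' = - \<alpha> P\<close>,
  so \<open>P(t) = exp (- \<alpha> t) P(0)\<close> (lemma \<open>combined_state_decays\<close>). Substituting
  \<open>v = P - \<alpha> (x - u)\<close> removes the second state and leaves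
  \<open>x' = u' - \<beta> L x - exp (- \<alpha> t) P(0)\<close>. The error of agent \<open>i\<close> is then split into the error of the
  average and the \<open>i\<close>-th entry of the disagreement \<open>\<Pi> x\<close>, where \<open>\<Pi>\<close> is \<^const>\<open>mean_proj\<close>.

  Average. Balance makes the column sums of \<open>L\<close> zero, so the average of \<open>v\<close> is constant, and averaging
  the decay of \<open>P\<close> shows that the average of \<open>x\<close>, corrected by the bias \<open>avg (v 0) / \<alpha>\<close>, approaches
  that of \<open>u\<close> at rate \<open>\<alpha>\<close> (lemma \<open>avg_error\<close>).

  Disagreement. Since \<open>L\<close> commutes with \<open>\<Pi>\<close>, the vector \<open>z = \<Pi> x\<close> satisfies
  \<open>z' = \<Pi> u' - \<beta> L z - exp (- \<alpha> t) \<Pi> P(0)\<close>. On sum-zero vectors \<open>z \<bullet> L z \<ge> lam * (z \<bullet> z)\<close>, because the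
  minimal Rayleigh quotient there is attained at an eigenvector whose eigenvalue strong connectivity
  keeps away from zero (lemma \<open>lambda2_hat_le_quadratic_form\<close>). Hence \<open>norm z\<close> is bounded by the solution
  of a scalar linear equation with damping \<open>\<beta> * lam\<close> (lemma \<open>norm_le_damped_integral\<close>): the input
  \<open>\<Pi> u'\<close> contributes the convolution integral, and the input \<open>exp (- \<alpha> t) \<Pi> P(0)\<close> contributes
  \<open>norm (\<Pi> P(0))\<close> times the convolution of the two exponentials, which is the gain function
  (lemma \<open>gain_fun_has_integral\<close>).

  Finally \<open>\<Pi> P(0) = \<Pi> (\<alpha> y(0) + w(0) + u'(0))\<close>, so its norm is at most
  \<open>\<alpha> * norm y(0) + norm w(0) + norm u'(0)\<close>, which accounts for every term multiplied by the gain.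
\<close>

section \<open>Spectral gap of a balanced Laplacian\<close>

lemma symmetric_matrix_inner:
  fixes M :: "real ^ 'n ^ 'n"
  assumes "transpose M = M"
  shows "x \<bullet> (M *v y) = (M *v x) \<bullet> y"
  using dot_lmul_matrix[of x M y] transpose_matrix_vector[of M x] assms by simp

text \<open>Eigenvectors to distinct eigenvalues are orthogonal, so choosing one for each eigenvalue gives an
  independent set. Finiteness is what makes \<^const>\<open>Min\<close> in \<^const>\<open>lambda2_hat\<close> a lower bound.\<close>

lemma finite_eigenvalues_symmetric:
  fixes M :: "real ^ 'n ^ 'n"
  assumes sym: "transpose M = M"
  shows "finite {c. eigenvalue M c}"
proof -
  define e where "e c = (SOME v. v \<noteq> 0 \<and> M *v v = c *\<^sub>R v)" for c
  have e: "e c \<noteq> 0 \<and> M *v e c = c *\<^sub>R e c" if "eigenvalue M c" for c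
    using someI_ex[OF that[unfolded eigenvalue_def]] by (simp add: e_def)
  let ?C = "{c. eigenvalue M c}"
  have orth: "e c \<bullet> e d = 0" if "c \<in> ?C" "d \<in> ?C" "c \<noteq> d" for c d
  proof -
    have "d * (e c \<bullet> e d) = c * (e c \<bullet> e d)"
      using symmetric_matrix_inner[OF sym, of "e c" "e d"] e that by simp
    then show ?thesis using that by simp
  qed
  have inj: "inj_on e ?C"
  proof (rule inj_onI, rule ccontr)
    fix c d assume *: "c \<in> ?C" "d \<in> ?C" "e c = e d" "c \<noteq> d"
    then show False using orth[of c d] e[of d] by auto
  qed
  have "independent (e ` ?C)"
    by (rule pairwise_orthogonal_independent)
       (use orth e in \<open>auto simp: pairwise_def orthogonal_def\<close>)
  then show ?thesis
    using independent_imp_finite finite_imageD[OF _ inj] by blast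
qed

text \<open>On an invariant subspace, a minimiser \<open>e\<close> of the Rayleigh quotient exists by compactness of the
  unit sphere. Its residual \<open>r = M e - \<mu> e\<close> stays in the subspace, and if it were nonzero then moving
  from \<open>e\<close> slightly against \<open>r\<close> would lower the quotient.\<close>

lemma least_rayleigh_quotient_is_eigenvalue:
  fixes M :: "real ^ 'n ^ 'n"
  assumes sym: "transpose M = M" and V: "subspace V"
    and inv: "\<And>x. x \<in> V \<Longrightarrow> M *v x \<in> V" and ne: "z0 \<in> V" "z0 \<noteq> 0"
  obtains \<mu> e where "e \<in> V" "e \<noteq> 0" "M *v e = \<mu> *\<^sub>R e"
    "\<And>z. z \<in> V \<Longrightarrow> \<mu> * (z \<bullet> z) \<le> z \<bullet> (M *v z)"
proof -
  have unit: "(1 / norm z) *\<^sub>R z \<in> sphere 0 1 \<inter> V" if "z \<in> V" "z \<noteq> 0" for z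
    using that V by (simp add: subspace_scale)
  have "compact (sphere 0 1 \<inter> V)"
    by (intro compact_Int_closed compact_sphere closed_subspace V)
  moreover have "sphere 0 1 \<inter> V \<noteq> {}" using unit[OF ne] by blast
  moreover have "continuous_on (sphere 0 1 \<inter> V) (\<lambda>x. x \<bullet> (M *v x))"
    by (intro continuous_intros)
  ultimately obtain e where e: "e \<in> sphere 0 1" "e \<in> V"
    and min: "\<And>z. z \<in> sphere 0 1 \<inter> V \<Longrightarrow> e \<bullet> (M *v e) \<le> z \<bullet> (M *v z)"
    using continuous_attains_inf[of "sphere 0 1 \<inter> V" "\<lambda>x. x \<bullet> (M *v x)"] by blast
  define \<mu> where "\<mu> = e \<bullet> (M *v e)"
  have ee: "e \<bullet> e = 1" using e by (simp add: dot_square_norm)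
  have quad: "\<mu> * (z \<bullet> z) \<le> z \<bullet> (M *v z)" if "z \<in> V" for z
  proof (cases "z = 0")
    case False
    have "\<mu> \<le> (z \<bullet> (M *v z)) / (z \<bullet> z)"
      using min[OF unit[OF that False]]
      by (simp add: \<mu>_def matrix_vector_mult_scaleR dot_square_norm power2_eq_square)
    then show ?thesis using False by (simp add: pos_le_divide_eq)
  qed simp
  define r where "r = M *v e - \<mu> *\<^sub>R e"
  have rV: "r \<in> V"
    unfolding r_def using V inv e by (simp add: subspace_diff subspace_scale)
  define C where "C = r \<bullet> (M *v r) - \<mu> * (r \<bullet> r)"
  have C: "C \<ge> 0" using quad[OF rV] by (simp add: C_def)
  \<comment> \<open>Expanding at the minimiser, the linear coefficient is twice the squared norm of the residual.\<close>
  have perturb: "0 \<le> 2 * s * (r \<bullet> r) + s\<^sup>2 * C" for s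
  proof -
    let ?w = "e + s *\<^sub>R r"
    have "?w \<in> V" using V e rV by (simp add: subspace_add subspace_scale)
    from quad[OF this] have "0 \<le> ?w \<bullet> (M *v ?w) - \<mu> * (?w \<bullet> ?w)" by simp
    also have "\<dots> = (e \<bullet> (M *v e) - \<mu> * (e \<bullet> e)) + 2 * s * (r \<bullet> (M *v e) - \<mu> * (r \<bullet> e)) + s\<^sup>2 * C"
    proof -
      have Mw: "M *v ?w = M *v e + s *\<^sub>R (M *v r)"
        by (simp add: matrix_vector_mult_scaleR matrix_vector_right_distrib)
      have er: "e \<bullet> (M *v r) = r \<bullet> (M *v e)" "e \<bullet> r = r \<bullet> e"
        using symmetric_matrix_inner[OF sym, of e r] by (simp_all add: inner_commute)
      show ?thesis
        unfolding Mw C_def inner_add_left inner_add_right inner_scaleR_left inner_scaleR_right er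
        by (simp add: algebra_simps power2_eq_square)
    qed
    also have "r \<bullet> (M *v e) - \<mu> * (r \<bullet> e) = r \<bullet> r"
      using inner_diff_right[of r "M *v e" "\<mu> *\<^sub>R e", folded r_def] by simp
    finally show ?thesis by (simp add: ee flip: \<mu>_def)
  qed
  \<comment> \<open>The step \<open>s = - q\<close> nearly minimises the quadratic; \<open>C + 1\<close> replaces \<open>C\<close> since \<open>C\<close> may vanish.\<close>
  define q where "q = r \<bullet> r / (C + 1)"
  have rr: "r \<bullet> r = q * (C + 1)" using C by (simp add: q_def)
  have "q\<^sup>2 * (C + 2) \<le> 0"
    using perturb[of "- q"] unfolding rr by (simp add: algebra_simps power2_eq_square)
  then have "q = 0" using C by (simp add: mult_le_0_iff)
  then have "r = 0" using rr by simp
  then have "M *v e = \<mu> *\<^sub>R e" by (simp add: r_def)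
  moreover have "e \<noteq> 0" using ee by auto
  ultimately show ?thesis using that e(2) quad by blast
qed

lemma laplacian_mult:
  "(laplacian A *v x) $ i = (\<Sum>j\<in>UNIV. A $ i $ j * (x $ i - x $ j))"
proof -
  have "(laplacian A *v x) $ i
      = (\<Sum>j\<in>UNIV. (if i = j then \<Sum>k\<in>UNIV. A $ i $ k else 0) * x $ j) - (\<Sum>j\<in>UNIV. A $ i $ j * x $ j)"
    by (simp add: laplacian_def out_degree_matrix_def matrix_vector_mult_def left_diff_distrib
        sum_subtractf)
  also have "(\<Sum>j\<in>UNIV. (if i = j then \<Sum>k\<in>UNIV. A $ i $ k else 0) * x $ j)
      = (\<Sum>j\<in>UNIV. if i = j then (\<Sum>k\<in>UNIV. A $ i $ k) * x $ j else 0)"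
    by (rule sum.cong) auto
  finally show ?thesis
    by (simp add: right_diff_distrib sum_subtractf sum_distrib_right)
qed

lemma laplacian_const: "laplacian A *v (\<chi> k. c) = 0"
  by (simp add: vec_eq_iff laplacian_mult)

text \<open>Column sums of the Laplacian vanish exactly because in-weights equal out-weights.\<close>

lemma sum_laplacian_balanced:
  assumes "weight_balanced A"
  shows "(\<Sum>i\<in>UNIV. (laplacian A *v x) $ i) = 0"
proof -
  have "(\<Sum>i\<in>UNIV. \<Sum>j\<in>UNIV. A $ i $ j * x $ i) = (\<Sum>i\<in>UNIV. \<Sum>j\<in>UNIV. A $ j $ i * x $ i)"
    using assms by (simp add: weight_balanced_def flip: sum_distrib_right)
  also have "\<dots> = (\<Sum>i\<in>UNIV. \<Sum>j\<in>UNIV. A $ i $ j * x $ j)" by (rule sum.swap)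
  finally show ?thesis by (simp add: laplacian_mult right_diff_distrib sum_subtractf)
qed

text \<open>The terms \<open>2 A\<^sub>i\<^sub>j x\<^sub>i (x\<^sub>i - x\<^sub>j)\<close> on the left become squares after subtracting the sum of the entries of
  the Laplacian applied to the vector of squares \<open>x\<^sub>k\<^sup>2\<close>, which is zero by balance.\<close>

lemma laplacian_quadratic_form:
  assumes "weight_balanced A"
  shows "2 * (x \<bullet> (laplacian A *v x)) = (\<Sum>i\<in>UNIV. \<Sum>j\<in>UNIV. A $ i $ j * (x $ i - x $ j)\<^sup>2)"
proof -
  have "2 * (x \<bullet> (laplacian A *v x)) = 2 * (x \<bullet> (laplacian A *v x))
      - (\<Sum>i\<in>UNIV. (laplacian A *v (\<chi> k. (x $ k)\<^sup>2)) $ i)"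
    using sum_laplacian_balanced[OF assms] by simp
  also have "\<dots> = (\<Sum>i\<in>UNIV. \<Sum>j\<in>UNIV. A $ i $ j * (x $ i - x $ j)\<^sup>2)"
    unfolding laplacian_mult inner_vec_def sum_distrib_left sum_subtractf[symmetric] inner_real_def
    by (intro sum.cong refl) (simp add: power2_eq_square algebra_simps)
  finally show ?thesis .
qed

text \<open>A vanishing sum of squares forces equal values across each edge, hence along directed paths.\<close>

lemma quadratic_form_zero_imp_const:
  assumes G: "weighted_digraph E A" "strongly_connected E" "weight_balanced A"
    and "x \<bullet> (laplacian A *v x) = 0"
  shows "x $ i = x $ j"
proof -
  have A: "A $ i $ j \<ge> 0" for i j
    using G(1) unfolding weighted_digraph_def by (metis less_eq_real_def)
  have "(\<Sum>i\<in>UNIV. \<Sum>j\<in>UNIV. A $ i $ j * (x $ i - x $ j)\<^sup>2) = 0"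
    using laplacian_quadratic_form[OF G(3), of x] assms(4) by simp
  then have "A $ i $ j * (x $ i - x $ j)\<^sup>2 = 0" for i j
    using A by (simp add: sum_nonneg_eq_0_iff sum_nonneg)
  then have edge: "x $ i = x $ j" if "(i, j) \<in> E" for i j
    using that G(1) unfolding weighted_digraph_def by (metis less_irrefl mult_eq_0_iff
      power_eq_0_iff right_minus_eq)
  have "(i, j) \<in> E\<^sup>*" using G(2) by (simp add: strongly_connected_def)
  then show ?thesis by (induction rule: rtrancl_induct) (auto dest: edge)
qed

text \<open>The symmetric part of the Laplacian has the same quadratic form and preserves the sum-zero
  vectors. Its least Rayleigh quotient \<open>\<mu>\<close> there is an eigenvalue, and it is nonzero because a null
  vector of the form is constant and a constant sum-zero vector is zero. So \<open>\<mu>\<close> is one of the nonzero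
  eigenvalues over which the minimum \<^const>\<open>lambda2_hat\<close> is taken.\<close>

lemma lambda2_hat_le_quadratic_form:
  fixes A :: "real ^ 'n ^ 'n"
  assumes G: "weighted_digraph E A" "strongly_connected E" "weight_balanced A"
    and z: "(\<Sum>i\<in>UNIV. z $ i) = 0"
  shows "lambda2_hat (laplacian A) * (z \<bullet> z) \<le> z \<bullet> (laplacian A *v z)"
proof (cases "z = 0")
  case False
  define L where "L = laplacian A"
  define M where "M = (1 / 2) *\<^sub>R (L + transpose L)"
  define V where "V = {x :: real ^ 'n. (\<chi> k. 1) \<bullet> x = 0}"
  have V_iff: "x \<in> V \<longleftrightarrow> (\<Sum>i\<in>UNIV. x $ i) = 0" for x
    by (simp add: V_def inner_vec_def)
  have sym: "transpose M = M"
    by (simp add: M_def transpose_def vec_eq_iff)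
  have M_mult: "M *v x = (1 / 2) *\<^sub>R (L *v x + transpose L *v x)" for x
    unfolding M_def by (simp only: scaleR_matrix_vector_assoc[symmetric] matrix_vector_mult_add_rdistrib)
  have swap: "x \<bullet> (transpose L *v y) = (L *v x) \<bullet> y" for x y
    by (metis dot_lmul_matrix inner_commute transpose_matrix_vector)
  have quadM: "x \<bullet> (M *v x) = x \<bullet> (L *v x)" for x
    using swap[of x x] by (simp add: M_mult inner_add_right inner_commute del: transpose_matrix_vector)
  have sub: "subspace V"
    unfolding V_def by (rule subspace_hyperplane)
  have inv: "M *v x \<in> V" for x
  proof -
    have "(\<chi> k. 1) \<bullet> (L *v x) = 0"
      using sum_laplacian_balanced[OF G(3), of x] by (simp add: L_def inner_vec_def)
    moreover have "(\<chi> k. 1) \<bullet> (transpose L *v x) = 0"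
      by (simp add: swap L_def[symmetric] laplacian_const[of A 1, folded L_def] del: transpose_matrix_vector)
    ultimately show ?thesis
      by (simp add: V_def M_mult inner_add_right del: transpose_matrix_vector)
  qed
  have "z \<in> V" using z by (simp add: V_iff)
  then obtain \<mu> e where e: "e \<in> V" "e \<noteq> 0" "M *v e = \<mu> *\<^sub>R e"
    and \<mu>: "\<And>z. z \<in> V \<Longrightarrow> \<mu> * (z \<bullet> z) \<le> z \<bullet> (M *v z)"
    using least_rayleigh_quotient_is_eigenvalue[OF sym sub inv _ False] by metis
  have "\<mu> \<noteq> 0"
  proof
    assume "\<mu> = 0"
    then have "e \<bullet> (laplacian A *v e) = 0" using quadM[of e] e(3) by (simp add: L_def)
    then have const: "e $ i = e $ j" for i j by (rule quadratic_form_zero_imp_const[OF G])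
    have "e $ i = 0" for i
    proof -
      have "(\<Sum>j\<in>UNIV. e $ j) = (\<Sum>j\<in>(UNIV :: 'n set). e $ i)" by (intro sum.cong refl const)
      then show ?thesis using e(1) by (simp add: V_iff)
    qed
    with e(2) show False by (simp add: vec_eq_iff)
  qed
  then have "\<mu> \<in> {c. eigenvalue M c \<and> c \<noteq> 0}"
    using e by (auto simp: eigenvalue_def)
  moreover have "finite {c. eigenvalue M c \<and> c \<noteq> 0}"
    by (rule finite_subset[OF _ finite_eigenvalues_symmetric[OF sym]]) auto
  ultimately have "lambda2_hat L \<le> \<mu>"
    unfolding lambda2_hat_def M_def[symmetric] by (simp add: Min_le)
  then have "lambda2_hat L * (z \<bullet> z) \<le> \<mu> * (z \<bullet> z)" by (intro mult_right_mono) auto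
  also have "\<dots> \<le> z \<bullet> (L *v z)" using \<mu>[OF \<open>z \<in> V\<close>] by (simp add: quadM)
  finally show ?thesis by (simp add: L_def)
qed simp

section \<open>Mean and disagreement of a vector\<close>

definition avg :: "real ^ 'n \<Rightarrow> real" where
  "avg x = (1 / real CARD('n)) * (\<Sum>j\<in>UNIV. x $ j)"

lemma bounded_linear_avg: "bounded_linear avg"
  unfolding avg_def
  by (intro bounded_linear_const_mult bounded_linear_sum bounded_linear_vec_nth)

lemma avg_add: "avg (x + y) = avg x + avg y"
  and avg_diff: "avg (x - y) = avg x - avg y"
  and avg_scaleR: "avg (c *\<^sub>R x) = c * avg x"
  by (simp_all add: linear_simps[OF bounded_linear_avg])

lemma avg_const [simp]: "avg (\<chi> k. c) = c"
  by (simp add: avg_def)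

lemma mean_proj_nth: "(mean_proj *v x) $ i = x $ i - avg x"
proof -
  have "mean_proj *v x = x - (1 / real CARD('a)) *\<^sub>R ((\<chi> i j. 1) *v x)"
    by (simp add: mean_proj_def matrix_vector_mult_diff_rdistrib scaleR_matrix_vector_assoc)
  then show ?thesis by (simp add: avg_def matrix_vector_mult_def)
qed

lemma mean_proj_eq: "mean_proj *v x = x - (\<chi> k. avg x)"
  by (simp add: vec_eq_iff mean_proj_nth)

lemma avg_mean_proj [simp]: "avg (mean_proj *v x) = 0"
  by (simp add: mean_proj_eq avg_diff)

lemma sum_eq_card_avg: "(\<Sum>j\<in>UNIV. x $ j) = real CARD('n) * avg x" for x :: "real ^ 'n"
  by (simp add: avg_def)

lemma mean_proj_inner: "(mean_proj *v x) \<bullet> y = x \<bullet> (mean_proj *v y)"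
proof -
  have "(\<chi> k. avg x) \<bullet> y = x \<bullet> (\<chi> k. avg y)"
    by (simp add: inner_vec_def sum_eq_card_avg flip: sum_distrib_left sum_distrib_right)
  then show ?thesis by (simp add: mean_proj_eq inner_diff_left inner_diff_right)
qed

lemma mean_proj_idem [simp]: "mean_proj *v (mean_proj *v x) = mean_proj *v x"
  by (subst mean_proj_eq) (simp add: vec_eq_iff)

text \<open>\<^const>\<open>mean_proj\<close> is idempotent and self-adjoint, so it is an orthogonal projection and contracts.\<close>

lemma norm_mean_proj_le: "norm (mean_proj *v x) \<le> norm x"
proof -
  have "norm (mean_proj *v x) * norm (mean_proj *v x) = x \<bullet> (mean_proj *v x)"
    using mean_proj_inner[of x "mean_proj *v x"] by (simp add: dot_square_norm power2_eq_square)
  also have "\<dots> \<le> norm x * norm (mean_proj *v x)" by (rule norm_cauchy_schwarz)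
  finally show ?thesis
    by (cases "norm (mean_proj *v x) = 0") auto
qed

lemma abs_avg_le_norm: "\<bar>avg x\<bar> \<le> norm x"
proof -
  have "\<bar>\<Sum>j\<in>UNIV. x $ j\<bar> \<le> (\<Sum>j\<in>(UNIV :: 'a set). norm x)"
    by (intro order_trans[OF sum_abs] sum_mono component_le_norm_cart)
  then show ?thesis by (simp add: avg_def abs_mult field_simps)
qed

lemma avg_laplacian: "weight_balanced A \<Longrightarrow> avg (laplacian A *v x) = 0"
  by (simp add: avg_def sum_laplacian_balanced)

lemma mean_proj_laplacian: "weight_balanced A \<Longrightarrow> mean_proj *v (laplacian A *v x) = laplacian A *v x"
  by (simp add: mean_proj_eq[of "laplacian A *v x"] avg_laplacian vec_eq_iff)

lemma laplacian_mean_proj: "laplacian A *v (mean_proj *v x) = laplacian A *v x"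
  by (simp add: vec_eq_iff laplacian_mult mean_proj_nth)

section \<open>Differential inequalities for the norm\<close>

text \<open>Formally \<open>norm Z\<close> has derivative \<open>Z \<bullet> Z' / norm Z \<le> F\<close>, but the norm is not differentiable at zeros
  of \<open>Z\<close>. The smooth majorant \<open>\<psi> = sqrt (Z \<bullet> Z + \<epsilon>\<^sup>2)\<close> satisfies the same estimate, as \<open>norm Z \<le> \<psi>\<close>,
  and exceeds the norm at the left endpoint by at most \<open>\<epsilon>\<close>.\<close>

lemma norm_le_norm_plus_integral:
  fixes Z :: "real \<Rightarrow> 'a::real_inner"
  assumes fin: "finite S" and ab: "a \<le> b" and cont: "continuous_on {a..b} Z"
    and der: "\<And>t. t \<in> {a<..<b} - S \<Longrightarrow> (Z has_vector_derivative Z' t) (at t)"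
    and le: "\<And>t. t \<in> {a<..<b} - S \<Longrightarrow> Z t \<bullet> Z' t \<le> norm (Z t) * F t"
    and F: "\<And>t. t \<in> {a..b} \<Longrightarrow> 0 \<le> F t" "F integrable_on {a..b}"
  shows "norm (Z b) \<le> norm (Z a) + integral {a..b} F"
proof (rule field_le_epsilon)
  fix \<epsilon> :: real assume \<epsilon>: "\<epsilon> > 0"
  define \<psi> where "\<psi> t = sqrt (Z t \<bullet> Z t + \<epsilon>\<^sup>2)" for t
  have pos: "Z t \<bullet> Z t + \<epsilon>\<^sup>2 > 0" for t using \<epsilon> by (simp add: add_nonneg_pos)
  have "\<psi> t > 0" for t using pos by (simp add: \<psi>_def)
  have Z_le: "norm (Z t) \<le> \<psi> t" for t
    by (simp add: \<psi>_def norm_eq_sqrt_inner)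
  have d\<psi>: "(\<psi> has_vector_derivative (Z t \<bullet> Z' t) / \<psi> t) (at t)" if "t \<in> {a<..<b} - S" for t
  proof -
    have "((\<lambda>t. Z t \<bullet> Z t + \<epsilon>\<^sup>2) has_real_derivative 2 * (Z t \<bullet> Z' t)) (at t)"
      using der[OF that] unfolding has_real_derivative_iff_has_vector_derivative has_vector_derivative_def
      by (auto intro!: derivative_eq_intros simp: inner_commute algebra_simps)
    from DERIV_chain2[OF DERIV_real_sqrt[OF pos] this]
    have "(\<psi> has_real_derivative inverse (sqrt (Z t \<bullet> Z t + \<epsilon>\<^sup>2)) / 2 * (2 * (Z t \<bullet> Z' t))) (at t)"
      unfolding \<psi>_def .
    then show ?thesis
      by (simp add: has_real_derivative_iff_has_vector_derivative \<psi>_def field_simps)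
  qed
  have bound: "(Z t \<bullet> Z' t) / \<psi> t \<le> F t" if "t \<in> {a<..<b} - S" for t
  proof -
    have "Z t \<bullet> Z' t \<le> norm (Z t) * F t" by (rule le[OF that])
    also have "\<dots> \<le> \<psi> t * F t" using F(1)[of t] that by (intro mult_right_mono Z_le) auto
    finally show ?thesis using \<open>\<psi> t > 0\<close> by (simp add: field_simps)
  qed
  have "continuous_on {a..b} \<psi>" unfolding \<psi>_def by (intro continuous_intros cont)
  then have "((\<lambda>t. (Z t \<bullet> Z' t) / \<psi> t) has_integral \<psi> b - \<psi> a) {a..b}"
    by (intro fundamental_theorem_of_calculus_interior_strong[OF fin ab d\<psi>])
  \<comment> \<open>At the endpoints and in \<open>S\<close> the bound on the integrand may fail, so its values there are changed to those of \<open>F\<close>.\<close>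
  then have "((\<lambda>t. if t \<in> S \<union> {a, b} then F t else (Z t \<bullet> Z' t) / \<psi> t) has_integral \<psi> b - \<psi> a) {a..b}"
    by (rule has_integral_spike_finite[rotated 2, where S = "S \<union> {a, b}"]) (use fin in auto)
  then have "\<psi> b - \<psi> a \<le> integral {a..b} F"
    by (rule has_integral_le[OF _ integrable_integral[OF F(2)]]) (use bound in auto)
  moreover have "\<psi> a \<le> norm (Z a) + \<epsilon>"
    unfolding \<psi>_def using \<epsilon> sqrt_add_le_add_sqrt[of "Z a \<bullet> Z a" "\<epsilon>\<^sup>2"]
    by (simp add: norm_eq_sqrt_inner)
  ultimately show "norm (Z b) \<le> norm (Z a) + integral {a..b} F + \<epsilon>"
    using Z_le[of b] by simp
qed

text \<open>The integrating factor \<open>exp (- c * (b - t))\<close> absorbs the damping term; it equals \<open>1\<close> at \<open>b\<close>, so the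
  undamped estimate applied to the product is already the claim.\<close>

lemma norm_le_damped_integral:
  fixes z :: "real \<Rightarrow> 'a::real_inner"
  assumes fin: "finite S" and ab: "a \<le> b" and cont: "continuous_on {a..b} z"
    and der: "\<And>t. t \<in> {a<..<b} - S \<Longrightarrow> (z has_vector_derivative z' t) (at t)"
    and le: "\<And>t. t \<in> {a<..<b} - S \<Longrightarrow> z t \<bullet> z' t \<le> - c * (z t \<bullet> z t) + norm (z t) * f t"
    and f: "\<And>t. t \<in> {a..b} \<Longrightarrow> 0 \<le> f t" "(\<lambda>t. exp (- c * (b - t)) * f t) integrable_on {a..b}"
  shows "norm (z b) \<le> exp (- c * (b - a)) * norm (z a) + integral {a..b} (\<lambda>t. exp (- c * (b - t)) * f t)"
proof -
  define h where "h t = exp (- c * (b - t))" for t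
  have "norm (h b *\<^sub>R z b) \<le> norm (h a *\<^sub>R z a) + integral {a..b} (\<lambda>t. h t * f t)"
  proof (rule norm_le_norm_plus_integral[OF fin ab])
    show "continuous_on {a..b} (\<lambda>t. h t *\<^sub>R z t)"
      unfolding h_def by (intro continuous_intros cont)
    show "((\<lambda>t. h t *\<^sub>R z t) has_vector_derivative h t *\<^sub>R (c *\<^sub>R z t + z' t)) (at t)"
      if "t \<in> {a<..<b} - S" for t
    proof -
      have "(h has_real_derivative h t * c) (at t)"
        unfolding h_def by (auto intro!: derivative_eq_intros)
      then show ?thesis using has_vector_derivative_scaleR[OF _ der[OF that]]
        by (fastforce simp: algebra_simps)
    qed
    show "(h t *\<^sub>R z t) \<bullet> (h t *\<^sub>R (c *\<^sub>R z t + z' t)) \<le> norm (h t *\<^sub>R z t) * (h t * f t)"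
      if "t \<in> {a<..<b} - S" for t
    proof -
      have h: "h t > 0" by (simp add: h_def)
      have "(h t *\<^sub>R z t) \<bullet> (h t *\<^sub>R (c *\<^sub>R z t + z' t)) = (h t)\<^sup>2 * (c * (z t \<bullet> z t) + z t \<bullet> z' t)"
        by (simp add: inner_add_right power2_eq_square algebra_simps)
      also have "\<dots> \<le> (h t)\<^sup>2 * (norm (z t) * f t)"
        using le[OF that] by (intro mult_left_mono) auto
      also have "\<dots> = norm (h t *\<^sub>R z t) * (h t * f t)"
        using h by (simp add: power2_eq_square)
      finally show ?thesis .
    qed
  qed (use f in \<open>auto simp: h_def\<close>)
  then show ?thesis by (simp add: h_def)
qed

text \<open>The gain is the response of a first-order system with rate \<open>\<beta> * lam\<close> to the input
  \<open>exp (- \<alpha> * \<tau>)\<close>; its two cases are the non-resonant and the resonant value of one integral.\<close>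

lemma gain_fun_has_integral:
  assumes "t \<ge> 0"
  shows "((\<lambda>\<tau>. exp (- \<beta> * lam * (t - \<tau>)) * exp (- \<alpha> * \<tau>)) has_integral gain_fun \<alpha> \<beta> lam t) {0..t}"
proof (cases "\<alpha> = \<beta> * lam")
  case True
  have "exp (- \<beta> * lam * (t - \<tau>)) * exp (- \<alpha> * \<tau>) = exp (- \<beta> * lam * t)" for \<tau>
    using True by (simp add: algebra_simps flip: exp_add)
  then show ?thesis
    using has_integral_const_real[of "exp (- \<beta> * lam * t)" 0 t] assms True
    by (simp add: gain_fun_def)
next
  case False
  define F where "F \<tau> = exp (- \<beta> * lam * t + (\<beta> * lam - \<alpha>) * \<tau>) / (\<beta> * lam - \<alpha>)" for \<tau>
  have "((\<lambda>\<tau>. exp (- \<beta> * lam * (t - \<tau>)) * exp (- \<alpha> * \<tau>)) has_integral F t - F 0) {0..t}"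
  proof (rule fundamental_theorem_of_calculus[OF assms])
    fix \<tau>
    have "(F has_real_derivative exp (- \<beta> * lam * t + (\<beta> * lam - \<alpha>) * \<tau>)) (at \<tau> within {0..t})"
      unfolding F_def using False by (auto intro!: derivative_eq_intros)
    then show "(F has_vector_derivative exp (- \<beta> * lam * (t - \<tau>)) * exp (- \<alpha> * \<tau>)) (at \<tau> within {0..t})"
      by (simp add: has_real_derivative_iff_has_vector_derivative algebra_simps flip: exp_add)
  qed
  moreover have "F t - F 0 = gain_fun \<alpha> \<beta> lam t"
    using False by (simp add: F_def gain_fun_def divide_inverse algebra_simps)
  ultimately show ?thesis by simp
qed

lemma gain_fun_nonneg: "t \<ge> 0 \<Longrightarrow> gain_fun \<alpha> \<beta> lam t \<ge> 0"
  using has_integral_nonneg[OF gain_fun_has_integral] by simp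

section \<open>Piecewise continuous inputs\<close>

text \<open>The function is measurable and dominated by a constant off a null set.\<close>

lemma integrable_bounded_continuous_off_finite:
  fixes f :: "real \<Rightarrow> real"
  assumes fin: "finite S" and cont: "continuous_on ({a..b} - S) f"
    and bdd: "bounded (f ` ({a..b} - S))"
  shows "f integrable_on {a..b}"
proof -
  obtain K where K: "\<And>t. t \<in> {a..b} - S \<Longrightarrow> norm (f t) \<le> K"
    using bdd unfolding bounded_iff by blast
  have meas: "{a..b} - S \<in> sets lebesgue"
    using fin by (intro sets.Diff) (auto intro: sets_completionI_sets simp: finite_imp_closed)
  have K_int: "(\<lambda>t. K) integrable_on ({a..b} - S)"
    by (rule integrable_spike_set[OF integrable_const_ivl[of K a b]])
       (auto intro!: negligible_finite finite_subset[OF _ fin])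
  have "f integrable_on ({a..b} - S)"
    by (rule measurable_bounded_by_integrable_imp_integrable
          [OF continuous_imp_measurable_on_sets_lebesgue[OF cont meas] K_int K meas]) auto
  then show ?thesis
    by (rule integrable_spike_set) (auto intro!: negligible_finite finite_subset[OF _ fin])
qed

lemma locally_bounded_on_compact_imp_bounded:
  fixes f :: "'a::topological_space \<Rightarrow> 'b::real_normed_vector"
  assumes K: "compact K"
    and loc: "\<And>x. x \<in> K \<Longrightarrow> \<exists>U. open U \<and> x \<in> U \<and> bounded (f ` (U \<inter> S))"
  shows "bounded (f ` (K \<inter> S))"
proof -
  obtain U where U: "\<And>x. x \<in> K \<Longrightarrow> open (U x) \<and> x \<in> U x \<and> bounded (f ` (U x \<inter> S))"
    using loc by metis
  obtain D where D: "D \<subseteq> K" "finite D" "K \<subseteq> (\<Union>x\<in>D. U x)"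
    by (rule compactE_image[OF K, of K U]) (use U in auto)
  have "bounded (\<Union>x\<in>D. f ` (U x \<inter> S))" using D U by (intro bounded_UN) auto
  then show ?thesis by (rule bounded_subset) (use D(3) in fastforce)
qed

lemma tendsto_imp_eventually_bounded:
  fixes f :: "'a \<Rightarrow> real"
  assumes "(f \<longlongrightarrow> l) F"
  shows "eventually (\<lambda>x. norm (f x) \<le> norm l + 1) F"
  using order_tendstoD(2)[OF tendsto_norm[OF assms], of "norm l + 1"]
  by (auto elim: eventually_mono)

text \<open>A piecewise continuous function is locally bounded, by continuity away from the breakpoints and
  by the two one-sided limits at a breakpoint; compactness of the interval does the rest.\<close>

lemma piecewise_continuous_bounded:
  assumes "piecewise_continuous B g"
  shows "bounded (g ` ({0..T} - B))"
proof -
  have "bounded (g ` ({0..T} \<inter> ({0..} - B)))"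
  proof (rule locally_bounded_on_compact_imp_bounded)
    fix b assume b: "b \<in> {0..T}"
    have "\<exists>K. eventually (\<lambda>t. t \<in> {0..} - B \<longrightarrow> norm (g t) \<le> K) (nhds b)"
    proof (cases "b \<in> B")
      case True
      then obtain l r where "(g \<longlongrightarrow> l) (at_left b)" "(g \<longlongrightarrow> r) (at_right b)"
        using assms by (auto simp: piecewise_continuous_def)
      then have "eventually (\<lambda>t. norm (g t) \<le> norm l + 1) (at_left b)"
        "eventually (\<lambda>t. norm (g t) \<le> norm r + 1) (at_right b)"
        by (auto intro!: tendsto_imp_eventually_bounded simp del: real_norm_def)
      then have "eventually (\<lambda>t. norm (g t) \<le> max (norm l) (norm r) + 1) (at b)"
        unfolding eventually_at_split by (auto elim!: eventually_mono)
      then have "eventually (\<lambda>t. t \<in> {0..} - B \<longrightarrow> norm (g t) \<le> max (norm l) (norm r) + 1) (nhds b)"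
        unfolding eventually_at_filter by eventually_elim (use True in auto)
      then show ?thesis by blast
    next
      case False
      then have "(g \<longlongrightarrow> g b) (at b within ({0..} - B))"
        using assms b by (auto simp: piecewise_continuous_def continuous_on_def)
      then have "eventually (\<lambda>t. norm (g t) \<le> norm (g b) + 1) (at b within ({0..} - B))"
        by (rule tendsto_imp_eventually_bounded)
      then have "eventually (\<lambda>t. t \<in> {0..} - B \<longrightarrow> norm (g t) \<le> norm (g b) + 1) (nhds b)"
        unfolding eventually_at_filter by eventually_elim auto
      then show ?thesis by blast
    qed
    then obtain K U where "open U" "b \<in> U" "\<And>t. t \<in> U \<Longrightarrow> t \<in> {0..} - B \<Longrightarrow> norm (g t) \<le> K"
      unfolding eventually_nhds by blast
    then show "\<exists>U. open U \<and> b \<in> U \<and> bounded (g ` (U \<inter> ({0..} - B)))"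
      by (intro exI[of _ U]) (auto simp: bounded_iff)
  qed simp
  moreover have "{0..T} \<inter> ({0..} - B) = {0..T} - B" by auto
  ultimately show ?thesis by simp
qed

lemma has_vector_derivative_cart:
  fixes f :: "real \<Rightarrow> real ^ 'n"
  assumes "\<And>i. ((\<lambda>s. f s $ i) has_real_derivative d $ i) (at t within S)"
  shows "(f has_vector_derivative d) (at t within S)"
  unfolding has_vector_derivative_def
proof (subst has_derivative_componentwise_within, rule ballI)
  fix b :: "real ^ 'n" assume "b \<in> Basis"
  then obtain i where b: "b = axis i 1" by (auto simp: Basis_vec_def)
  show "((\<lambda>x. f x \<bullet> b) has_derivative (\<lambda>x. (x *\<^sub>R d) \<bullet> b)) (at t within S)"
    using assms[of i] unfolding has_field_derivative_def
    by (simp add: b inner_axis mult_commute_abs)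
qed

lemma finite_breakpoints:
  fixes B :: "'n::finite \<Rightarrow> real set"
  assumes "\<And>i. piecewise_cont_diff (B i) (\<lambda>t. u t $ i)"
  shows "finite ((\<Union>i. B i) \<inter> {..T})"
proof -
  have "finite (B i \<inter> {..T})" for i
    using assms[of i] by (simp add: piecewise_cont_diff_def piecewise_continuous_def)
  then have "finite (\<Union>i. B i \<inter> {..T})" by (intro finite_UN_I finite)
  moreover have "(\<Union>i. B i) \<inter> {..T} = (\<Union>i. B i \<inter> {..T})" by auto
  ultimately show ?thesis by (simp only:)
qed

lemma continuous_on_input:
  fixes u :: "real \<Rightarrow> real ^ 'n"
  assumes "\<And>i. piecewise_cont_diff (B i) (\<lambda>t. u t $ i)"
  shows "continuous_on {0..} u"
proof -
  have "continuous_on {0..} (\<lambda>t. \<chi> i. u t $ i)"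
    using assms by (intro continuous_on_vec_lambda) (simp add: piecewise_cont_diff_def)
  then show ?thesis by simp
qed

lemma input_has_vector_derivative:
  fixes u :: "real \<Rightarrow> real ^ 'n"
  assumes "\<And>i. piecewise_cont_diff (B i) (\<lambda>t. u t $ i)" and "t \<in> {0..} - (\<Union>i. B i)"
  shows "(u has_vector_derivative input_deriv u t) (at t within {0..})"
proof (rule has_vector_derivative_cart)
  fix i
  have "(\<lambda>s. u s $ i) differentiable (at t within {0..})"
    using assms by (auto simp: piecewise_cont_diff_def)
  then show "((\<lambda>s. u s $ i) has_real_derivative input_deriv u t $ i) (at t within {0..})"
    by (simp add: has_real_derivative_iff_has_vector_derivative input_deriv_def half_line_deriv_def
        vector_derivative_works)
qed

text \<open>An \<^const>\<open>integral\<close> that does not exist has the value \<open>0\<close>, so the integral in the error bound is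
  meaningful only once integrability is known. On \<open>[0, t]\<close> the integrand is bounded, and continuous
  away from the finitely many breakpoints.\<close>

lemma integrable_damped_input_deriv:
  fixes u :: "real \<Rightarrow> real ^ 'n" and B :: "'n \<Rightarrow> real set"
  assumes u: "\<And>i. piecewise_cont_diff (B i) (\<lambda>t. u t $ i)"
  shows "(\<lambda>\<tau>. exp (c * (t - \<tau>)) * norm (mean_proj *v input_deriv u \<tau>)) integrable_on {0..t}"
proof -
  define S where "S = (\<Union>i. B i) \<inter> {..t}"
  have pc: "piecewise_continuous (B i) (half_line_deriv (\<lambda>s. u s $ i))" for i
    using u[of i] by (simp add: piecewise_cont_diff_def)
  have sub: "{0..t} - S \<subseteq> {0..t} - B i" for i by (auto simp: S_def)
  have cont: "continuous_on ({0..t} - S) (input_deriv u)"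
    unfolding input_deriv_def
  proof (rule continuous_on_vec_lambda)
    fix i
    have "continuous_on ({0..} - B i) (half_line_deriv (\<lambda>s. u s $ i))"
      using pc[of i] by (simp add: piecewise_continuous_def)
    then show "continuous_on ({0..t} - S) (\<lambda>s. half_line_deriv (\<lambda>s. u s $ i) s)"
      by (rule continuous_on_subset) (auto simp: S_def)
  qed
  have "\<exists>K. \<forall>s\<in>{0..t} - S. \<bar>input_deriv u s $ i\<bar> \<le> K" for i
    using bounded_subset[OF piecewise_continuous_bounded[OF pc[of i]] image_mono[OF sub[of i]]]
    by (simp add: bounded_iff input_deriv_def)
  then obtain K where K: "\<And>i s. s \<in> {0..t} - S \<Longrightarrow> \<bar>input_deriv u s $ i\<bar> \<le> K i" by metis
  have E: "exp (c * (t - s)) \<le> exp (\<bar>c\<bar> * t)" if "s \<in> {0..t} - S" for s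
  proof -
    have "c * (t - s) \<le> \<bar>c\<bar> * (t - s)" using that by (intro mult_right_mono) auto
    also have "\<dots> \<le> \<bar>c\<bar> * t" using that by (intro mult_left_mono) auto
    finally show ?thesis by simp
  qed
  show ?thesis
  proof (rule integrable_bounded_continuous_off_finite)
    show "finite S" unfolding S_def by (rule finite_breakpoints[OF u])
    show "continuous_on ({0..t} - S) (\<lambda>\<tau>. exp (c * (t - \<tau>)) * norm (mean_proj *v input_deriv u \<tau>))"
      by (intro continuous_intros cont
          bounded_linear.continuous_on[OF matrix_vector_mul_bounded_linear])
    show "bounded ((\<lambda>\<tau>. exp (c * (t - \<tau>)) * norm (mean_proj *v input_deriv u \<tau>)) ` ({0..t} - S))"
    proof (intro boundedI[where B = "exp (\<bar>c\<bar> * t) * (\<Sum>i\<in>UNIV. K i)"], clarify)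
      fix s assume s: "s \<in> {0..t}" "s \<notin> S"
      have "norm (mean_proj *v input_deriv u s) \<le> norm (input_deriv u s)" by (rule norm_mean_proj_le)
      also have "\<dots> \<le> (\<Sum>i\<in>UNIV. \<bar>input_deriv u s $ i\<bar>)" by (rule norm_le_l1_cart)
      also have "\<dots> \<le> (\<Sum>i\<in>UNIV. K i)" using K s by (intro sum_mono) auto
      finally show "norm (exp (c * (t - s)) * norm (mean_proj *v input_deriv u s))
          \<le> exp (\<bar>c\<bar> * t) * (\<Sum>i\<in>UNIV. K i)"
        using E[of s] s by (simp add: abs_mult mult_mono)
    qed
  qed
qed

section \<open>Decay along trajectories\<close>

lemma trajectory_has_vector_derivative:
  fixes x v :: "real \<Rightarrow> real ^ 'n"
  assumes "consensus_trajectory \<alpha> \<beta> L u S x v" "t \<in> {0..} - S"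
  shows "(x has_vector_derivative
           input_deriv u t - \<alpha> *\<^sub>R (x t - u t) - \<beta> *\<^sub>R (L *v x t) - v t) (at t within {0..})"
    and "(v has_vector_derivative (\<alpha> * \<beta>) *\<^sub>R (L *v x t)) (at t within {0..})"
  using assms
  by (auto intro!: has_vector_derivative_cart simp: consensus_trajectory_def matrix_vector_mult_def)

lemma constant_if_derivative_zero:
  fixes f :: "real \<Rightarrow> 'a::banach"
  assumes "finite (S \<inter> {..t})" "continuous_on {0..} f" "t \<ge> 0"
    and "\<And>s. s \<in> {0..} - S \<Longrightarrow> (f has_vector_derivative 0) (at s within {0..})"
  shows "f t = f 0"
proof (rule has_derivative_zero_unique_strong_interval[where k = "S \<inter> {..t}" and a = 0 and b = t])
  show "(f has_derivative (\<lambda>h. 0)) (at s within {0..t})" if "s \<in> {0..t} - (S \<inter> {..t})" for s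
  proof (rule has_derivative_subset)
    show "(f has_derivative (\<lambda>h. 0)) (at s within {0..})"
      using assms(4)[of s] that by (auto simp: has_vector_derivative_def)
  qed auto
  show "continuous_on {0..t} f" by (rule continuous_on_subset[OF assms(2)]) auto
qed (use assms in auto)

text \<open>In \<open>P = \<alpha> x + v - \<alpha> u\<close> the Laplacian terms of \<open>\<alpha> x'\<close> and \<open>v'\<close> cancel and so does \<open>\<alpha> u'\<close>, leaving
  \<open>P' = - \<alpha> P\<close>.\<close>

lemma combined_state_decays:
  fixes u x v :: "real \<Rightarrow> real ^ 'n" and B :: "'n \<Rightarrow> real set"
  assumes u: "\<And>i. piecewise_cont_diff (B i) (\<lambda>t. u t $ i)"
    and tr: "consensus_trajectory \<alpha> \<beta> L u (\<Union>i. B i) x v" and t: "t \<ge> 0"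
  shows "\<alpha> *\<^sub>R x t + v t - \<alpha> *\<^sub>R u t = exp (- \<alpha> * t) *\<^sub>R (\<alpha> *\<^sub>R x 0 + v 0 - \<alpha> *\<^sub>R u 0)"
proof -
  define P where "P s = \<alpha> *\<^sub>R x s + v s - \<alpha> *\<^sub>R u s" for s
  have dP: "(P has_vector_derivative - \<alpha> *\<^sub>R P s) (at s within {0..})" if s: "s \<in> {0..} - (\<Union>i. B i)" for s
  proof -
    note d = trajectory_has_vector_derivative[OF tr s] input_has_vector_derivative[OF u s]
    have "(P has_vector_derivative
        \<alpha> *\<^sub>R (input_deriv u s - \<alpha> *\<^sub>R (x s - u s) - \<beta> *\<^sub>R (L *v x s) - v s)
        + (\<alpha> * \<beta>) *\<^sub>R (L *v x s) - \<alpha> *\<^sub>R input_deriv u s) (at s within {0..})"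
      unfolding P_def
      by (intro has_vector_derivative_add has_vector_derivative_diff
          bounded_linear.has_vector_derivative[OF bounded_linear_scaleR_right] d)
    then show ?thesis by (simp add: P_def algebra_simps)
  qed
  have cont: "continuous_on {0..} P"
    unfolding P_def using tr continuous_on_input[OF u]
    by (intro continuous_intros) (auto simp: consensus_trajectory_def)
  have "exp (\<alpha> * t) *\<^sub>R P t = exp (\<alpha> * 0) *\<^sub>R P 0"
  proof (rule constant_if_derivative_zero[OF finite_breakpoints[OF u] _ t])
    show "continuous_on {0..} (\<lambda>s. exp (\<alpha> * s) *\<^sub>R P s)" by (intro continuous_intros cont)
    show "((\<lambda>s. exp (\<alpha> * s) *\<^sub>R P s) has_vector_derivative 0) (at s within {0..})"
      if s: "s \<in> {0..} - (\<Union>i. B i)" for s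
    proof -
      have "((\<lambda>s. exp (\<alpha> * s)) has_real_derivative exp (\<alpha> * s) * \<alpha>) (at s within {0..})"
        by (auto intro!: derivative_eq_intros)
      from has_vector_derivative_scaleR[OF this dP[OF s]] show ?thesis by (simp add: algebra_simps)
    qed
  qed
  then have "exp (- \<alpha> * t) *\<^sub>R exp (\<alpha> * t) *\<^sub>R P t = exp (- \<alpha> * t) *\<^sub>R P 0" by simp
  then show ?thesis by (simp add: P_def flip: exp_add)
qed

lemma avg_v_conserved:
  fixes u x v :: "real \<Rightarrow> real ^ 'n" and B :: "'n \<Rightarrow> real set"
  assumes u: "\<And>i. piecewise_cont_diff (B i) (\<lambda>t. u t $ i)" and bal: "weight_balanced A"
    and tr: "consensus_trajectory \<alpha> \<beta> (laplacian A) u (\<Union>i. B i) x v" and t: "t \<ge> 0"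
  shows "avg (v t) = avg (v 0)"
proof (rule constant_if_derivative_zero[OF finite_breakpoints[OF u] _ t])
  show "continuous_on {0..} (\<lambda>s. avg (v s))"
    using tr by (intro bounded_linear.continuous_on[OF bounded_linear_avg])
      (simp add: consensus_trajectory_def)
  show "((\<lambda>s. avg (v s)) has_vector_derivative 0) (at s within {0..})" if "s \<in> {0..} - (\<Union>i. B i)" for s
    using bounded_linear.has_vector_derivative[OF bounded_linear_avg
        trajectory_has_vector_derivative(2)[OF tr that]]
    by (simp add: avg_scaleR avg_laplacian[OF bal])
qed

text \<open>The average of the decaying combination is the error of the average, up to the factor \<open>\<alpha>\<close>, once the
  average of \<open>v\<close> is known to be conserved. The offset \<open>avg (v 0) / \<alpha>\<close> is the steady-state bias that a
  nonzero initial average of \<open>v\<close> leaves behind.\<close>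

lemma avg_error:
  fixes u x v :: "real \<Rightarrow> real ^ 'n" and B :: "'n \<Rightarrow> real set"
  assumes u: "\<And>i. piecewise_cont_diff (B i) (\<lambda>t. u t $ i)" and bal: "weight_balanced A"
    and tr: "consensus_trajectory \<alpha> \<beta> (laplacian A) u (\<Union>i. B i) x v" and t: "t \<ge> 0"
    and \<alpha>: "\<alpha> > 0"
  shows "avg (x t) - avg (u t) + avg (v 0) / \<alpha>
    = exp (- \<alpha> * t) * (avg (x 0) - avg (u 0) + avg (v 0) / \<alpha>)"
proof -
  have "\<alpha> * avg (x t) + avg (v 0) - \<alpha> * avg (u t)
      = exp (- \<alpha> * t) * (\<alpha> * avg (x 0) + avg (v 0) - \<alpha> * avg (u 0))"
    using arg_cong[OF combined_state_decays[OF u tr t], of avg] avg_v_conserved[OF u bal tr t]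
    by (simp add: avg_add avg_diff avg_scaleR)
  then have "\<alpha> * (avg (x t) - avg (u t) + avg (v 0) / \<alpha>)
      = \<alpha> * (exp (- \<alpha> * t) * (avg (x 0) - avg (u 0) + avg (v 0) / \<alpha>))"
    using \<alpha> by (simp add: algebra_simps)
  then show ?thesis using \<alpha> by simp
qed

text \<open>Eliminating \<open>v\<close> through the decaying combination turns the equation for \<open>x\<close> into
  \<open>x' = u' - \<beta> L x - exp (- \<alpha> t) P(0)\<close>. Its projection is a first-order system on the sum-zero vectors,
  where the Laplacian damps at rate at least \<open>\<beta> * lam\<close>; the two forcing terms give the integral and the
  gain term.\<close>

lemma disagreement_bound:
  fixes u x v :: "real \<Rightarrow> real ^ 'n" and B :: "'n \<Rightarrow> real set"
  assumes G: "weighted_digraph E A" "strongly_connected E" "weight_balanced A"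
    and u: "\<And>i. piecewise_cont_diff (B i) (\<lambda>t. u t $ i)"
    and tr: "consensus_trajectory \<alpha> \<beta> (laplacian A) u (\<Union>i. B i) x v"
    and t: "t \<ge> 0" and \<beta>: "\<beta> > 0"
  defines "lam \<equiv> lambda2_hat (laplacian A)"
  shows "norm (mean_proj *v x t)
    \<le> exp (- \<beta> * lam * t) * norm (mean_proj *v x 0)
      + integral {0..t} (\<lambda>\<tau>. exp (- \<beta> * lam * (t - \<tau>)) * norm (mean_proj *v input_deriv u \<tau>))
      + gain_fun \<alpha> \<beta> lam t * norm (mean_proj *v (\<alpha> *\<^sub>R x 0 + v 0 - \<alpha> *\<^sub>R u 0))"
proof -
  define L where "L = laplacian A"
  define p where "p = mean_proj *v (\<alpha> *\<^sub>R x 0 + v 0 - \<alpha> *\<^sub>R u 0)"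
  define z where "z s = mean_proj *v x s" for s
  define z' where "z' s = mean_proj *v input_deriv u s - \<beta> *\<^sub>R (L *v z s) - exp (- \<alpha> * s) *\<^sub>R p" for s
  define f where "f s = norm (mean_proj *v input_deriv u s) + exp (- \<alpha> * s) * norm p" for s
  define h where "h s = exp (- (\<beta> * lam) * (t - s))" for s
  have dz: "(z has_vector_derivative z' s) (at s)"
    if "s \<in> {0<..<t} - ((\<Union>i. B i) \<inter> {..t})" for s
  proof -
    have s: "s \<in> {0..} - (\<Union>i. B i)" and "s > 0" using that by auto
    have "input_deriv u s - \<alpha> *\<^sub>R (x s - u s) - \<beta> *\<^sub>R (L *v x s) - v s
        = input_deriv u s - \<beta> *\<^sub>R (L *v x s) - exp (- \<alpha> * s) *\<^sub>R (\<alpha> *\<^sub>R x 0 + v 0 - \<alpha> *\<^sub>R u 0)"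
      unfolding combined_state_decays[OF u tr less_imp_le[OF \<open>s > 0\<close>], symmetric]
      by (simp add: algebra_simps)
    from trajectory_has_vector_derivative(1)[OF tr s, folded L_def, unfolded this]
    have "(x has_vector_derivative input_deriv u s - \<beta> *\<^sub>R (L *v x s)
        - exp (- \<alpha> * s) *\<^sub>R (\<alpha> *\<^sub>R x 0 + v 0 - \<alpha> *\<^sub>R u 0)) (at s within {0..})" .
    moreover have "at s within {0..} = at s"
      using \<open>s > 0\<close> by (intro at_within_interior) (simp add: interior_real_atLeast)
    ultimately have "(z has_vector_derivative mean_proj *v (input_deriv u s - \<beta> *\<^sub>R (L *v x s)
        - exp (- \<alpha> * s) *\<^sub>R (\<alpha> *\<^sub>R x 0 + v 0 - \<alpha> *\<^sub>R u 0))) (at s)"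
      unfolding z_def by (metis bounded_linear.has_vector_derivative matrix_vector_mul_bounded_linear)
    also have "mean_proj *v (input_deriv u s - \<beta> *\<^sub>R (L *v x s)
        - exp (- \<alpha> * s) *\<^sub>R (\<alpha> *\<^sub>R x 0 + v 0 - \<alpha> *\<^sub>R u 0)) = z' s"
      unfolding z'_def z_def p_def L_def laplacian_mean_proj
      by (simp only: matrix_vector_mult_diff_distrib matrix_vector_mult_scaleR mean_proj_laplacian[OF G(3)])
    finally show ?thesis .
  qed
  have le: "z s \<bullet> z' s \<le> - (\<beta> * lam) * (z s \<bullet> z s) + norm (z s) * f s" for s
  proof -
    have "(\<Sum>i\<in>UNIV. z s $ i) = 0" by (simp add: sum_eq_card_avg z_def)
    then have "lam * (z s \<bullet> z s) \<le> z s \<bullet> (L *v z s)"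
      unfolding lam_def L_def by (rule lambda2_hat_le_quadratic_form[OF G])
    then have "\<beta> * (lam * (z s \<bullet> z s)) \<le> \<beta> * (z s \<bullet> (L *v z s))" using \<beta> by simp
    moreover have "z s \<bullet> (mean_proj *v input_deriv u s) \<le> norm (z s) * norm (mean_proj *v input_deriv u s)"
      by (rule norm_cauchy_schwarz)
    moreover have "- (z s \<bullet> p) \<le> norm (z s) * norm p"
      using norm_cauchy_schwarz[of "z s" "- p"] by simp
    then have "exp (- \<alpha> * s) * - (z s \<bullet> p) \<le> exp (- \<alpha> * s) * (norm (z s) * norm p)"
      by (intro mult_left_mono) auto
    ultimately show ?thesis
      by (simp add: z'_def f_def inner_diff_right algebra_simps)
  qed
  have int1: "(\<lambda>s. h s * norm (mean_proj *v input_deriv u s)) integrable_on {0..t}"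
    unfolding h_def by (rule integrable_damped_input_deriv[OF u])
  have int2: "((\<lambda>s. h s * exp (- \<alpha> * s) * norm p) has_integral gain_fun \<alpha> \<beta> lam t * norm p) {0..t}"
    using has_integral_mult_left[OF gain_fun_has_integral[OF t, of \<beta> lam \<alpha>], of "norm p"]
    by (simp add: h_def)
  have int: "((\<lambda>s. h s * f s) has_integral
      integral {0..t} (\<lambda>s. h s * norm (mean_proj *v input_deriv u s)) + gain_fun \<alpha> \<beta> lam t * norm p) {0..t}"
    using has_integral_add[OF integrable_integral[OF int1] int2]
    by (simp add: f_def distrib_left mult.assoc)
  have "norm (z t) \<le> exp (- (\<beta> * lam) * (t - 0)) * norm (z 0) + integral {0..t} (\<lambda>s. h s * f s)"
    unfolding h_def
  proof (rule norm_le_damped_integral[OF finite_breakpoints[OF u] t _ dz le])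
    show "continuous_on {0..t} z"
      unfolding z_def using tr
      by (intro bounded_linear.continuous_on[OF matrix_vector_mul_bounded_linear])
         (auto simp: consensus_trajectory_def intro: continuous_on_subset)
    show "(\<lambda>s. exp (- (\<beta> * lam) * (t - s)) * f s) integrable_on {0..t}"
      using has_integral_integrable[OF int] by (simp add: h_def)
  qed (auto simp: f_def)
  then show ?thesis
    using integral_unique[OF int] by (simp add: z_def p_def h_def)
qed

theorem theorem4p1:
  fixes E :: "('n::finite \<times> 'n) set"
    and A :: "real ^ 'n ^ 'n"
    and u x v :: "real \<Rightarrow> real ^ 'n"
    and B :: "'n \<Rightarrow> real set"
    and \<alpha> \<beta> :: real
  assumes "CARD('n) \<ge> 2"
    and "weighted_digraph E A"
    and "strongly_connected E"
    and "weight_balanced A"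
    and "\<And>i. piecewise_cont_diff (B i) (\<lambda>t. u t $ i)"
    and "\<alpha> > 0" and "\<beta> > 0"
    and "consensus_trajectory \<alpha> \<beta> (laplacian A) u (\<Union>i. B i) x v"
  shows "\<forall>i. \<forall>t\<ge>0.
    (let lam = lambda2_hat (laplacian A);
         N = real CARD('n);
         y0 = x 0 - ((1 / N) * (\<Sum>j\<in>UNIV. u 0 $ j)) *\<^sub>R (\<chi> k. 1);
         w0 = v 0 - mean_proj *v (input_deriv u 0 + \<alpha> *\<^sub>R u 0)
     in \<bar>x t $ i - (1 / N) * (\<Sum>j\<in>UNIV. u t $ j) + (inverse \<alpha> / N) * (\<Sum>j\<in>UNIV. v 0 $ j)\<bar>
        \<le> transient_fun \<alpha> \<beta> lam y0 w0 t
          + integral {0..t} (\<lambda>\<tau>. exp (- \<beta> * lam * (t - \<tau>)) * norm (mean_proj *v input_deriv u \<tau>))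
          + gain_fun \<alpha> \<beta> lam t * norm (input_deriv u 0))"
proof (intro allI impI)
  fix i and t :: real assume t: "t \<ge> 0"
  note u = assms(5) and tr = assms(8)
  define lam where "lam = lambda2_hat (laplacian A)"
  define y0 where "y0 = x 0 - (\<chi> k. avg (u 0))"
  define w0 where "w0 = v 0 - mean_proj *v (input_deriv u 0 + \<alpha> *\<^sub>R u 0)"
  define I where
    "I = integral {0..t} (\<lambda>\<tau>. exp (- \<beta> * lam * (t - \<tau>)) * norm (mean_proj *v input_deriv u \<tau>))"
  define p where "p = mean_proj *v (\<alpha> *\<^sub>R x 0 + v 0 - \<alpha> *\<^sub>R u 0)"
  let ?g = "gain_fun \<alpha> \<beta> lam t"
  have y0_proj: "mean_proj *v y0 = mean_proj *v x 0"
    by (simp add: y0_def vec_eq_iff mean_proj_nth avg_diff)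
  have avg_y0: "avg y0 = avg (x 0) - avg (u 0)" by (simp add: y0_def avg_diff)
  have avg_w0: "avg w0 = avg (v 0)" by (simp add: w0_def avg_diff)
  \<comment> \<open>The derivative of the input enters \<open>w0\<close> with a minus sign, which adding it back cancels.\<close>
  have p_le: "norm p \<le> \<alpha> * norm y0 + norm w0 + norm (input_deriv u 0)"
  proof -
    have "p = mean_proj *v (\<alpha> *\<^sub>R y0 + w0 + input_deriv u 0)"
      unfolding p_def w0_def
      by (simp only: matrix_vector_right_distrib matrix_vector_mult_diff_distrib
          matrix_vector_mult_scaleR mean_proj_idem y0_proj) simp
    also have "norm \<dots> \<le> norm (\<alpha> *\<^sub>R y0 + w0 + input_deriv u 0)" by (rule norm_mean_proj_le)
    also have "\<dots> \<le> norm (\<alpha> *\<^sub>R y0) + norm w0 + norm (input_deriv u 0)"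
      by (intro order_trans[OF norm_triangle_ineq] add_right_mono norm_triangle_ineq)
    finally show ?thesis using assms(6) by simp
  qed
  have "\<bar>(mean_proj *v x t) $ i\<bar> \<le> norm (mean_proj *v x t)" by (rule component_le_norm_cart)
  also have "\<dots> \<le> exp (- \<beta> * lam * t) * norm (mean_proj *v x 0) + I + ?g * norm p"
    unfolding I_def p_def lam_def by (rule disagreement_bound[OF assms(2-4) u tr t assms(7)])
  also have "\<dots> \<le> exp (- \<beta> * lam * t) * norm y0 + I
      + ?g * (\<alpha> * norm y0 + norm w0 + norm (input_deriv u 0))"
    using norm_mean_proj_le[of y0]
    by (intro add_mono mult_left_mono p_le gain_fun_nonneg t) (simp_all add: y0_proj)
  finally have dis: "\<bar>(mean_proj *v x t) $ i\<bar> \<le> \<dots>" .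
  have "\<bar>avg (x t) - avg (u t) + avg (v 0) / \<alpha>\<bar> = exp (- \<alpha> * t) * \<bar>avg y0 + avg w0 / \<alpha>\<bar>"
    unfolding avg_error[OF u assms(4) tr t assms(6)] avg_y0 avg_w0 by (simp add: abs_mult)
  also have "\<dots> \<le> exp (- \<alpha> * t) * (norm y0 + norm w0 / \<alpha>)"
  proof (intro mult_left_mono order_trans[OF abs_triangle_ineq] add_mono abs_avg_le_norm)
    show "\<bar>avg w0 / \<alpha>\<bar> \<le> norm w0 / \<alpha>"
      using abs_avg_le_norm[of w0] assms(6) by (simp add: divide_right_mono)
  qed simp
  finally have avg: "\<bar>avg (x t) - avg (u t) + avg (v 0) / \<alpha>\<bar> \<le> \<dots>" .
  have split: "x t $ i - avg (u t) + avg (v 0) / \<alpha>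
      = (mean_proj *v x t) $ i + (avg (x t) - avg (u t) + avg (v 0) / \<alpha>)"
    by (simp add: mean_proj_nth)
  have bound: "\<bar>x t $ i - avg (u t) + avg (v 0) / \<alpha>\<bar>
      \<le> transient_fun \<alpha> \<beta> lam y0 w0 t + I + ?g * norm (input_deriv u 0)"
    unfolding split transient_fun_def
    using abs_triangle_ineq[of "(mean_proj *v x t) $ i" "avg (x t) - avg (u t) + avg (v 0) / \<alpha>"] dis avg
    by (simp add: algebra_simps divide_inverse)
  have y0_eq: "x 0 - ((1 / real CARD('n)) * (\<Sum>j\<in>UNIV. u 0 $ j)) *\<^sub>R (\<chi> k. 1) = y0"
    by (simp add: y0_def avg_def vec_eq_iff)
  have v_eq: "(inverse \<alpha> / real CARD('n)) * (\<Sum>j\<in>UNIV. v 0 $ j) = avg (v 0) / \<alpha>"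
    by (simp add: avg_def field_simps)
  show "let lam = lambda2_hat (laplacian A);
         N = real CARD('n);
         y0 = x 0 - ((1 / N) * (\<Sum>j\<in>UNIV. u 0 $ j)) *\<^sub>R (\<chi> k. 1);
         w0 = v 0 - mean_proj *v (input_deriv u 0 + \<alpha> *\<^sub>R u 0)
     in \<bar>x t $ i - (1 / N) * (\<Sum>j\<in>UNIV. u t $ j) + (inverse \<alpha> / N) * (\<Sum>j\<in>UNIV. v 0 $ j)\<bar>
        \<le> transient_fun \<alpha> \<beta> lam y0 w0 t
          + integral {0..t} (\<lambda>\<tau>. exp (- \<beta> * lam * (t - \<tau>)) * norm (mean_proj *v input_deriv u \<tau>))
          + gain_fun \<alpha> \<beta> lam t * norm (input_deriv u 0)"
    using bound unfolding Let_def y0_eq v_eq by (simp only: avg_def I_def w0_def lam_def)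
qed

end
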